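(* Let $P$ be a school choice problem with student set $I$ and school set $S$, and let $I = Y \cup Z$ with $Y \cap Z = \emptyset$ and $Y, Z \neq \emptyset$, where $Y$ is the set of advantaged students and $Z$ the set of marginalized students, such that at every school $s \in S$ every student in $Y$ has higher priority than every student in $Z$. Then no directed cycle in the DA envy digraph $G^{\mathrm{DA}}(P)$ contains both an advantaged student and a marginalized student.
   Context: A school choice problem $P$ consists of a finite set $I$ of students, a finite set $S$ of schools, for each student $i$ a strict (linear) preference $\succ_i$ over $S$, and for each school $s$ a quota $q_s$ (a positive integer) and a strict (linear) priority order $\triangleright_s$ over $I$. The set $S$ may contain a null school $s_\emptyset$, which has unlimited capacity; students assigned to $s_\emptyset$ are called unassigned. If $S$ contains no null school, it is assumed that $\sum_{s\in S} q_s \ge |I|$, so that matchings exist. A matching $\mu$ is a map $I \to S$, $i \mapsto \mu_i$, with $|\mu^{-1}_s| \le q_s$ for every $s \in S$, where $\mu^{-1}_s = \{i \in I : \mu_i = s\}$. The student-proposing Deferred Acceptance (DA) mechanism: in round 1 every student applies to her most preferred school, and every school tentatively accepts the highest-priority applicants up to its quota and rejects the rest; in each later round every student rejected in the previous round applies to her next best school, and every school, among its new applicants and its previously accepted students, tentatively keeps the highest-priority ones up to its quota and rejects the rest; the procedure stops when there is a round without any rejection. The resulting matching is denoted $\mathrm{DA}(P)$, with $\mathrm{DA}_i(P)$ the school of student $i$. The DA envy digraph $G^{\mathrm{DA}}(P)$ has node set $I$, with a directed edge $i \to j$ if and only if student $i$ strictly prefers $\mathrm{DA}_j(P)$ to $\mathrm{DA}_i(P)$,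 i.e. $\mathrm{DA}_j(P) \succ_i \mathrm{DA}_i(P)$. *)

theory Defs
  imports
    "HOL-Library.Extended_Nat"
    "HOL-Library.While_Combinator"
    "Graph_Theory.Arc_Walk"
begin

text \<open>
  Preferences and priorities are strict orders read from better to worse:
  \<open>(s, t) \<in> pref P i\<close> means that student \<open>i\<close> prefers school \<open>s\<close> to school \<open>t\<close>, and
  \<open>(i, j) \<in> prio P s\<close> that \<open>i\<close> has higher priority than \<open>j\<close> at \<open>s\<close>.
  \<open>null_school P = None\<close> means that there is no null school.
\<close>

record ('i, 's) problem =
  students :: "'i set"
  schools :: "'s set"
  pref :: "'i \<Rightarrow> 's rel"
  quota :: "'s \<Rightarrow> nat"
  prio :: "'s \<Rightarrow> 'i rel"
  null_school :: "'s option"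

definition capacity :: "('i, 's) problem \<Rightarrow> 's \<Rightarrow> enat" where
  "capacity P s = (if null_school P = Some s then \<infinity> else enat (quota P s))"

text \<open>
  The library predicate \<open>strict_linear_order_on A r\<close> does not entail \<open>r \<subseteq> A \<times> A\<close>.
\<close>

definition strict_linear_order_over :: "'a set \<Rightarrow> 'a rel \<Rightarrow> bool" where
  "strict_linear_order_over A r \<longleftrightarrow> r \<subseteq> A \<times> A \<and> strict_linear_order_on A r"

definition school_choice_problem :: "('i, 's) problem \<Rightarrow> bool" where
  "school_choice_problem P \<longleftrightarrow>
     finite (students P) \<and> finite (schools P) \<and>
     (\<forall>i\<in>students P. strict_linear_order_over (schools P) (pref P i)) \<and>
     (\<forall>s\<in>schools P. 0 < capacity P s \<and> strict_linear_order_over (students P) (prio P s)) \<and>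
     (case null_school P of
        None \<Rightarrow> card (students P) \<le> (\<Sum>s\<in>schools P. quota P s)
      | Some n \<Rightarrow> n \<in> schools P)"

definition best :: "('i, 's) problem \<Rightarrow> 'i \<Rightarrow> 's set \<Rightarrow> 's" where
  "best P i A = (THE s. s \<in> A \<and> (\<forall>t\<in>A - {s}. (s, t) \<in> pref P i))"

text \<open>
  A round of Deferred Acceptance is described by the map \<open>a\<close> sending each student to the
  school to which she has most recently applied. The students \<open>j\<close> with \<open>a j = s\<close> are thus
  exactly the new applicants of \<open>s\<close> together with those tentatively accepted by \<open>s\<close> in the
  previous round. A school keeps the highest-priority ones among these up to its
  capacity, so \<open>i\<close> is rejected iff the capacity is already used up by competitors
  that have higher priority than \<open>i\<close>.
\<close>

definition rejected :: "('i, 's) problem \<Rightarrow> ('i \<Rightarrow> 's) \<Rightarrow> 'i set" where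
  "rejected P a =
     {i \<in> students P. capacity P (a i)
        \<le> enat (card {j \<in> students P. a j = a i \<and> (j, i) \<in> prio P (a i)})}"

text \<open>
  The set from which a rejected student picks her next school is never empty if
  \<open>school_choice_problem P\<close> holds, since then the schools cannot all be full without her.
\<close>

definition next_round :: "('i, 's) problem \<Rightarrow> ('i \<Rightarrow> 's) \<Rightarrow> ('i \<Rightarrow> 's)" where
  "next_round P a =
     (\<lambda>i. if i \<in> rejected P a then best P i {t \<in> schools P. (a i, t) \<in> pref P i} else a i)"

definition DA :: "('i, 's) problem \<Rightarrow> 'i \<Rightarrow> 's" where
  "DA P = while (\<lambda>a. rejected P a \<noteq> {}) (next_round P) (\<lambda>i. best P i (schools P))"

definition envy_digraph :: "('i, 's) problem \<Rightarrow> ('i, 'i \<times> 'i) pre_digraph" where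
  "envy_digraph P =
     \<lparr> verts = students P,
       arcs = {(i, j) \<in> students P \<times> students P. (DA P j, DA P i) \<in> pref P i},
       tail = fst, head = snd \<rparr>"

end

theory Submission
  imports Defs
begin

text \<open>
  Deferred Acceptance keeps the invariant that every school which a student prefers to her
  current one is filled with applicants of higher priority. In the outcome, an advantaged
  student who envied a marginalized one would thus find the latter's school filled with
  students of higher priority than both, so that the marginalized student would be rejected.
  Hence no arc of the envy digraph leaves the set of advantaged students for the marginalized
  ones, and a cycle meeting both sets would need such an arc.
\<close>

section \<open>Strict linear orders\<close>

lemma strict_linear_order_overD:
  assumes "strict_linear_order_over A r"
  shows "r \<subseteq> A \<times> A" "trans r" "irrefl r" "total_on A r"
  using assms by (auto simp: strict_linear_order_over_def strict_linear_order_on_def)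

lemma strict_linear_order_over_asym:
  assumes "strict_linear_order_over A r" "(x, y) \<in> r"
  shows "(y, x) \<notin> r"
  using strict_linear_order_overD(2,3)[OF assms(1)] assms(2) by (meson irrefl_def transD)

lemma ex_top:
  assumes "strict_linear_order_over A r" "finite B" "B \<subseteq> A" "B \<noteq> {}"
  shows "\<exists>m\<in>B. \<forall>x\<in>B - {m}. (m, x) \<in> r"
  using assms(2,4,3)
proof (induction B rule: finite_ne_induct)
  case (singleton x)
  then show ?case by simp
next
  case (insert x B)
  then obtain m where m: "m \<in> B" "\<forall>y\<in>B - {m}. (m, y) \<in> r" by auto
  have "(x, m) \<in> r \<or> (m, x) \<in> r"
    using strict_linear_order_overD(4)[OF assms(1)] insert m(1) by (auto simp: total_on_def)
  then show ?case
  proof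
    assume "(x, m) \<in> r"
    have "(x, y) \<in> r" if "y \<in> B" for y
      using that m(2) \<open>(x, m) \<in> r\<close> transD[OF strict_linear_order_overD(2)[OF assms(1)], of x m y]
      by (cases "y = m") auto
    then show ?thesis by auto
  next
    assume "(m, x) \<in> r"
    then show ?thesis using m by blast
  qed
qed

text \<open>If fewer than \<open>q\<close> elements were counted, the first element of
  \<open>H\<close> outside the counted set would have all its predecessors inside it, hence fewer
  than \<open>q\<close> of them, and would itself be counted. For a school with quota
  \<open>q\<close>: out of at least \<open>q\<close> applicants, at least \<open>q\<close>
  survive.\<close>

lemma card_top_ge:
  assumes r: "strict_linear_order_over A r" and H: "finite H" "H \<subseteq> A" and q: "q \<le> card H"
  shows "q \<le> card {j \<in> H. card {k \<in> H. (k, j) \<in> r} < q}" (is "_ \<le> card ?K")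
proof (rule ccontr)
  assume "\<not> ?thesis"
  then have K: "card ?K < q" by simp
  have "H - ?K \<noteq> {}"
  proof
    assume "H - ?K = {}"
    then have "?K = H" by blast
    then show False using K q by simp
  qed
  moreover have "finite (H - ?K)" "H - ?K \<subseteq> A" using H by auto
  ultimately obtain m where m: "m \<in> H - ?K" "\<forall>x\<in>H - ?K - {m}. (m, x) \<in> r"
    using ex_top[OF r] by blast
  have "{k \<in> H. (k, m) \<in> r} \<subseteq> ?K"
  proof
    fix k assume k: "k \<in> {k \<in> H. (k, m) \<in> r}"
    then have "k \<noteq> m" "(m, k) \<notin> r"
      using strict_linear_order_over_asym[OF r] by blast+
    then show "k \<in> ?K" using m(2) k by blast
  qed
  then have "card {k \<in> H. (k, m) \<in> r} \<le> card ?K"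
    using H(1) by (intro card_mono) auto
  then show False using K m(1) by auto
qed

section \<open>Deferred Acceptance\<close>

text \<open>Asymmetry allows only one top element, so the description in \<open>best\<close> denotes
  the one given by \<open>ex_top\<close>.\<close>

lemma best_props:
  assumes r: "strict_linear_order_over (schools P) (pref P i)"
    and A: "finite A" "A \<subseteq> schools P" "A \<noteq> {}"
  shows "best P i A \<in> A" "\<And>t. t \<in> A \<Longrightarrow> t \<noteq> best P i A \<Longrightarrow> (best P i A, t) \<in> pref P i"
proof -
  obtain m where m: "m \<in> A" "\<forall>t\<in>A - {m}. (m, t) \<in> pref P i"
    using ex_top[OF r A] by blast
  have "best P i A = m"
    unfolding best_def
  proof (rule the_equality)
    fix s assume "s \<in> A \<and> (\<forall>t\<in>A - {s}. (s, t) \<in> pref P i)"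
    then show "s = m"
      using m strict_linear_order_over_asym[OF r] by blast
  qed (use m in auto)
  then show "best P i A \<in> A" "\<And>t. t \<in> A \<Longrightarrow> t \<noteq> best P i A \<Longrightarrow> (best P i A, t) \<in> pref P i"
    using m by auto
qed

definition better_applicants :: "('i, 's) problem \<Rightarrow> ('i \<Rightarrow> 's) \<Rightarrow> 's \<Rightarrow> 'i \<Rightarrow> 'i set" where
  "better_applicants P a s i = {j \<in> students P. a j = s \<and> (j, i) \<in> prio P s}"

text \<open>For \<open>s = a i\<close> this is rejection. For other schools it says that an
  application of \<open>i\<close> would fail, which is what the invariant records about better
  schools.\<close>

definition full_for :: "('i, 's) problem \<Rightarrow> ('i \<Rightarrow> 's) \<Rightarrow> 's \<Rightarrow> 'i \<Rightarrow> bool" where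
  "full_for P a s i \<longleftrightarrow> capacity P s \<le> enat (card (better_applicants P a s i))"

lemma rejected_iff: "i \<in> rejected P a \<longleftrightarrow> i \<in> students P \<and> full_for P a (a i) i"
  by (simp add: rejected_def full_for_def better_applicants_def)

text \<open>The top \<open>q\<close> among the applicants above \<open>i\<close> each have fewer
  than \<open>q\<close> competitors ahead of them. None of them is rejected, so they all stay at
  \<open>s\<close>.\<close>

lemma full_for_next_round:
  assumes P: "school_choice_problem P" and s: "s \<in> schools P" and full: "full_for P a s i"
  shows "full_for P (next_round P a) s i"
proof -
  have r: "strict_linear_order_over (students P) (prio P s)" and fin: "finite (students P)"
    using P s by (auto simp: school_choice_problem_def)
  let ?H = "better_applicants P a s i"
  have H: "finite ?H" "?H \<subseteq> students P" using fin by (auto simp: better_applicants_def)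
  \<comment> \<open>Being at most a finite cardinality, the capacity cannot be infinite.\<close>
  obtain q where q: "capacity P s = enat q" "q \<le> card ?H"
    using full by (cases "capacity P s") (auto simp: full_for_def)
  have "{j \<in> ?H. card {k \<in> ?H. (k, j) \<in> prio P s} < q} \<subseteq> better_applicants P (next_round P a) s i"
  proof
    fix j assume j: "j \<in> {j \<in> ?H. card {k \<in> ?H. (k, j) \<in> prio P s} < q}"
    \<comment> \<open>Since \<open>j\<close> is above \<open>i\<close>, everyone above
      \<open>j\<close> is above \<open>i\<close> too: counting inside \<open>?H\<close> loses no
      competitor of \<open>j\<close>.\<close>
    then have "{k \<in> ?H. (k, j) \<in> prio P s} = better_applicants P a s j"
      using strict_linear_order_overD(2)[OF r] by (auto simp: better_applicants_def dest: transD)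
    then have "j \<notin> rejected P a"
      using j q(1) by (auto simp: rejected_iff full_for_def better_applicants_def)
    then show "j \<in> better_applicants P (next_round P a) s i"
      using j by (auto simp: better_applicants_def next_round_def)
  qed
  then have "card {j \<in> ?H. card {k \<in> ?H. (k, j) \<in> prio P s} < q}
      \<le> card (better_applicants P (next_round P a) s i)"
    using fin by (intro card_mono) (auto simp: better_applicants_def)
  then show ?thesis
    using card_top_ge[OF r H q(2)] q(1) by (simp add: full_for_def)
qed

text \<open>Otherwise a null school would have its infinite capacity bounded by a finite number, and
  without one the quotas would sum to at most the number of students other than \<open>i\<close>,
  because the sets of applicants are disjoint and avoid \<open>i\<close>.\<close>

lemma ex_school_not_full_for:
  assumes P: "school_choice_problem P" and i: "i \<in> students P"
  shows "\<exists>s\<in>schools P. \<not> full_for P a s i"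
proof (rule ccontr)
  assume "\<not> ?thesis"
  then have full: "full_for P a s i" if "s \<in> schools P" for s using that by blast
  have fin: "finite (students P)" "finite (schools P)"
    using P by (auto simp: school_choice_problem_def)
  show False
  proof (cases "null_school P")
    case None
    have ir: "(i, i) \<notin> prio P s" if "s \<in> schools P" for s
    proof -
      have "strict_linear_order_over (students P) (prio P s)"
        using P that by (simp add: school_choice_problem_def)
      then show ?thesis using strict_linear_order_over_asym by metis
    qed
    have "card (students P) \<le> (\<Sum>s\<in>schools P. quota P s)"
      using P None by (simp add: school_choice_problem_def)
    also have "\<dots> \<le> (\<Sum>s\<in>schools P. card (better_applicants P a s i))"
      using full None by (intro sum_mono) (simp add: full_for_def capacity_def)
    also have "\<dots> = card (\<Union>s\<in>schools P. better_applicants P a s i)"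
      using fin by (intro card_UN_disjoint[symmetric]) (auto simp: better_applicants_def)
    also have "\<dots> \<le> card (students P - {i})"
      using fin ir by (intro card_mono) (auto simp: better_applicants_def)
    also have "\<dots> < card (students P)"
      using fin(1) i by (rule card_Diff1_less)
    finally show False by simp
  next
    case (Some n)
    then show False
      using P full[of n] by (simp add: school_choice_problem_def full_for_def capacity_def)
  qed
qed

definition DA_invariant :: "('i, 's) problem \<Rightarrow> ('i \<Rightarrow> 's) \<Rightarrow> bool" where
  "DA_invariant P a \<longleftrightarrow>
     (\<forall>i\<in>students P. a i \<in> schools P \<and> (\<forall>s. (s, a i) \<in> pref P i \<longrightarrow> full_for P a s i))"

lemma DA_invariant_initial:
  assumes P: "school_choice_problem P"
  shows "DA_invariant P (\<lambda>i. best P i (schools P))"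
  unfolding DA_invariant_def
proof (intro ballI conjI allI impI)
  fix i assume i: "i \<in> students P"
  have r: "strict_linear_order_over (schools P) (pref P i)" and fin: "finite (schools P)"
    using P i by (auto simp: school_choice_problem_def)
  \<comment> \<open>Nonemptiness follows from the capacity condition once there is a
    student.\<close>
  have "schools P \<noteq> {}" using ex_school_not_full_for[OF P i] by blast
  note b = best_props[OF r fin subset_refl this]
  show "best P i (schools P) \<in> schools P" by (rule b)
  fix s assume s: "(s, best P i (schools P)) \<in> pref P i"
  then have "s \<in> schools P" "s \<noteq> best P i (schools P)"
    using strict_linear_order_overD(1,3)[OF r] by (auto simp: irrefl_def)
  \<comment> \<open>No school beats the first choice, so the invariant holds vacuously here.\<close>
  then have False using b(2) s strict_linear_order_over_asym[OF r] by blast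
  then show "full_for P (\<lambda>i. best P i (schools P)) s i" ..
qed

text \<open>\<open>best\<close> is meaningful only on a nonempty set. The invariant makes every
  school better than \<open>a i\<close> full for \<open>i\<close>, and the rejection makes
  \<open>a i\<close> full as well, so a school that is not full for her must lie in
  \<open>T\<close>.\<close>

lemma rejected_next_best:
  assumes P: "school_choice_problem P" and inv: "DA_invariant P a" and i: "i \<in> rejected P a"
  defines "T \<equiv> {t \<in> schools P. (a i, t) \<in> pref P i}"
  shows "next_round P a i \<in> T" "\<And>t. t \<in> T \<Longrightarrow> t \<noteq> next_round P a i \<Longrightarrow> (next_round P a i, t) \<in> pref P i"
proof -
  have i': "i \<in> students P" "full_for P a (a i) i" using i by (auto simp: rejected_iff)
  have r: "strict_linear_order_over (schools P) (pref P i)" and fin: "finite (schools P)"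
    using P i' by (auto simp: school_choice_problem_def)
  obtain t where t: "t \<in> schools P" "\<not> full_for P a t i"
    using ex_school_not_full_for[OF P i'(1)] by blast
  have "a i \<in> schools P" "(t, a i) \<notin> pref P i" "t \<noteq> a i"
    using inv i' t by (auto simp: DA_invariant_def)
  then have "t \<in> T"
    using strict_linear_order_overD(4)[OF r] t(1) by (auto simp: T_def total_on_def)
  then have T: "finite T" "T \<subseteq> schools P" "T \<noteq> {}" using fin by (auto simp: T_def)
  have n: "next_round P a i = best P i T" using i by (simp add: next_round_def T_def)
  show "next_round P a i \<in> T" "\<And>t. t \<in> T \<Longrightarrow> t \<noteq> next_round P a i \<Longrightarrow> (next_round P a i, t) \<in> pref P i"
    unfolding n using best_props[OF r T] by blast+
qed

lemma DA_invariant_next_round: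
  assumes P: "school_choice_problem P" and inv: "DA_invariant P a"
  shows "DA_invariant P (next_round P a)"
  unfolding DA_invariant_def
proof (intro ballI conjI allI impI)
  fix i assume i: "i \<in> students P"
  have r: "strict_linear_order_over (schools P) (pref P i)"
    using P i by (auto simp: school_choice_problem_def)
  have a: "a i \<in> schools P" "\<And>s. (s, a i) \<in> pref P i \<Longrightarrow> full_for P a s i"
    using inv i by (auto simp: DA_invariant_def)
  show "next_round P a i \<in> schools P"
    using rejected_next_best(1)[OF P inv, of i] a(1) by (cases "i \<in> rejected P a") (auto simp: next_round_def)
  fix s assume s: "(s, next_round P a i) \<in> pref P i"
  then have sS: "s \<in> schools P" using strict_linear_order_overD(1)[OF r] by blast
  have "full_for P a s i"
  proof (cases "i \<in> rejected P a")
    case True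
    \<comment> \<open>The new school is the best one below \<open>a i\<close>, so no
      \<open>s\<close> lies strictly between the two.\<close>
    have "(a i, s) \<notin> pref P i"
      using rejected_next_best(2)[OF P inv True, of s] sS s strict_linear_order_over_asym[OF r] by blast
    then have "s = a i \<or> (s, a i) \<in> pref P i"
      using strict_linear_order_overD(4)[OF r] sS a(1) by (auto simp: total_on_def)
    then show ?thesis using a(2) True by (auto simp: rejected_iff)
  next
    case False
    then show ?thesis using s a(2) by (simp add: next_round_def)
  qed
  then show "full_for P (next_round P a) s i" by (rule full_for_next_round[OF P sS])
qed

text \<open>The termination measure: how far all students together can still move down their
  lists.\<close>

definition remaining :: "('i, 's) problem \<Rightarrow> ('i \<Rightarrow> 's) \<Rightarrow> nat" where
  "remaining P a = (\<Sum>i\<in>students P. card {t \<in> schools P. (a i, t) \<in> pref P i})"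

text \<open>A rejected student moves down, and her new school drops out of the set of schools below
  her current one; the sets of the other students do not change.\<close>

lemma remaining_next_round:
  assumes P: "school_choice_problem P" and inv: "DA_invariant P a" and ne: "rejected P a \<noteq> {}"
  shows "remaining P (next_round P a) < remaining P a"
proof -
  let ?T = "\<lambda>a i. {t \<in> schools P. (a i, t) \<in> pref P i}"
  have fin: "finite (students P)" "finite (schools P)"
    using P by (auto simp: school_choice_problem_def)
  have less: "card (?T (next_round P a) i) < card (?T a i)" if i: "i \<in> rejected P a" for i
  proof -
    have r: "strict_linear_order_over (schools P) (pref P i)"
      using P i by (auto simp: school_choice_problem_def rejected_iff)
    have "next_round P a i \<in> ?T a i" by (rule rejected_next_best(1)[OF P inv i])
    moreover have "next_round P a i \<notin> ?T (next_round P a) i"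
      using strict_linear_order_overD(3)[OF r] by (auto simp: irrefl_def)
    moreover have "?T (next_round P a) i \<subseteq> ?T a i"
      using \<open>next_round P a i \<in> ?T a i\<close> strict_linear_order_overD(2)[OF r] by (auto dest: transD)
    ultimately show ?thesis using fin(2) by (intro psubset_card_mono) auto
  qed
  have "card (?T (next_round P a) i) \<le> card (?T a i)" for i
    using less[of i] by (cases "i \<in> rejected P a") (auto simp: next_round_def)
  moreover have "\<exists>i\<in>students P. card (?T (next_round P a) i) < card (?T a i)"
  proof -
    obtain i where i: "i \<in> rejected P a" using ne by blast
    then have "i \<in> students P" by (simp add: rejected_iff)
    then show ?thesis using less[OF i] by blast
  qed
  ultimately show ?thesis
    unfolding remaining_def using fin(1) by (intro sum_strict_mono_ex1) auto
qed

lemma DA_terminates: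
  assumes P: "school_choice_problem P"
  shows "DA_invariant P (DA P)" "rejected P (DA P) = {}"
proof -
  have "DA_invariant P (DA P) \<and> rejected P (DA P) = {}"
    unfolding DA_def
  \<comment> \<open>The invariant also serves termination, since it guarantees that a rejected
    student has a next school.\<close>
  proof (rule while_rule[where P = "DA_invariant P" and r = "measure (remaining P)"])
    show "DA_invariant P (\<lambda>i. best P i (schools P))" by (rule DA_invariant_initial[OF P])
  qed (auto intro: DA_invariant_next_round[OF P] remaining_next_round[OF P])
  then show "DA_invariant P (DA P)" "rejected P (DA P) = {}" by auto
qed

lemma DA_no_justified_envy:
  assumes P: "school_choice_problem P" and ij: "i \<in> students P" "j \<in> students P"
    and envy: "(DA P j, DA P i) \<in> pref P i"
  shows "(i, j) \<notin> prio P (DA P j)"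
proof
  let ?s = "DA P j"
  assume pr: "(i, j) \<in> prio P ?s"
  have s: "?s \<in> schools P" and full: "full_for P (DA P) ?s i"
    using DA_terminates(1)[OF P] ij envy by (auto simp: DA_invariant_def)
  have "strict_linear_order_over (students P) (prio P ?s)" and fin: "finite (students P)"
    using P s by (auto simp: school_choice_problem_def)
  then have "trans (prio P ?s)" by (blast dest: strict_linear_order_overD)
  \<comment> \<open>By transitivity whoever is above \<open>i\<close> is above \<open>j\<close>, so
    the school is full for \<open>j\<close> as well.\<close>
  then have "card (better_applicants P (DA P) ?s i) \<le> card (better_applicants P (DA P) ?s j)"
    using pr fin by (intro card_mono) (auto simp: better_applicants_def dest: transD)
  then have "full_for P (DA P) ?s j"
    using full unfolding full_for_def by (meson enat_ord_simps(1) order_trans)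
  then have "j \<in> rejected P (DA P)" using ij by (simp add: rejected_iff)
  then show False using DA_terminates(2)[OF P] by simp
qed

section \<open>Walks and sets closed under arcs\<close>

context pre_digraph
begin

lemma cas_closed_verts:
  assumes "\<forall>e\<in>arcs G. tail G e \<in> Y \<longrightarrow> head G e \<in> Y"
    and "set p \<subseteq> arcs G" "cas u p v" "u \<in> Y"
  shows "set (awalk_verts u p) \<subseteq> Y"
  using assms(2-4) by (induction p arbitrary: u) (use assms(1) in auto)

text \<open>A walk that enters \<open>Y\<close> cannot leave it again. On a closed walk the end is
  also the start, so \<open>cas_closed_verts\<close> then puts the whole walk inside
  \<open>Y\<close>.\<close>

lemma cas_closed_end:
  assumes "\<forall>e\<in>arcs G. tail G e \<in> Y \<longrightarrow> head G e \<in> Y"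
    and "set p \<subseteq> arcs G" "cas u p v" "set (awalk_verts u p) \<inter> Y \<noteq> {}"
  shows "v \<in> Y"
  using assms(2-4)
proof (induction p arbitrary: u)
  case Nil
  then show ?case by simp
next
  case (Cons e p)
  have "set (awalk_verts (head G e) p) \<inter> Y \<noteq> {}"
  proof (cases "tail G e \<in> Y")
    case True
    then have "head G e \<in> Y" using assms(1) Cons.prems by auto
    \<comment> \<open>\<open>awalk_verts\<close> lists its start directly only for the empty walk;
      otherwise it lists the tail of the first arc, which \<open>cas\<close> equates with the
      start.\<close>
    moreover have "head G e \<in> set (awalk_verts (head G e) p)"
      using Cons.prems by (cases p) auto
    ultimately show ?thesis by blast
  next
    case False
    then show ?thesis using Cons.prems by auto
  qed
  then show ?case using Cons by auto
qed

end

theorem proposition3: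
  fixes P :: "('i, 's) problem" and Y Z :: "'i set"
  assumes "school_choice_problem P"
    and "students P = Y \<union> Z" and "Y \<inter> Z = {}" and "Y \<noteq> {}" and "Z \<noteq> {}"
    and "\<forall>s\<in>schools P. \<forall>y\<in>Y. \<forall>z\<in>Z. (y, z) \<in> prio P s"
  shows "\<not> (\<exists>u p. pre_digraph.cycle (envy_digraph P) p \<and>
           pre_digraph.awalk (envy_digraph P) u p u \<and>
           (\<exists>y\<in>Y. y \<in> set (pre_digraph.awalk_verts (envy_digraph P) u p)) \<and>
           (\<exists>z\<in>Z. z \<in> set (pre_digraph.awalk_verts (envy_digraph P) u p)))"
proof
  let ?G = "envy_digraph P"
  have no_arc: "(DA P z, DA P y) \<notin> pref P y" if "y \<in> Y" "z \<in> Z" for y z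
  proof
    assume "(DA P z, DA P y) \<in> pref P y"
    \<comment> \<open>The priority of \<open>Y\<close> over \<open>Z\<close> is assumed only at
      members of \<open>schools P\<close>.\<close>
    moreover have "DA P z \<in> schools P"
      using DA_terminates(1)[OF assms(1)] assms(2) that by (auto simp: DA_invariant_def)
    ultimately show False
      using DA_no_justified_envy[OF assms(1), of y z] assms(2,6) that by blast
  qed
  have closed: "\<forall>e\<in>arcs ?G. tail ?G e \<in> Y \<longrightarrow> head ?G e \<in> Y"
    using no_arc assms(2) by (auto simp: envy_digraph_def)
  assume "\<exists>u p. pre_digraph.cycle ?G p \<and> pre_digraph.awalk ?G u p u \<and>
           (\<exists>y\<in>Y. y \<in> set (pre_digraph.awalk_verts ?G u p)) \<and>
           (\<exists>z\<in>Z. z \<in> set (pre_digraph.awalk_verts ?G u p))"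
  then obtain u p y z where w: "pre_digraph.awalk ?G u p u"
    and y: "y \<in> Y" "y \<in> set (pre_digraph.awalk_verts ?G u p)"
    and z: "z \<in> Z" "z \<in> set (pre_digraph.awalk_verts ?G u p)" by blast
  have p: "set p \<subseteq> arcs ?G" "pre_digraph.cas ?G u p u"
    using w by (auto simp: pre_digraph.awalk_def)
  have "u \<in> Y" using pre_digraph.cas_closed_end[OF closed p] y by blast
  then have "z \<in> Y" using pre_digraph.cas_closed_verts[OF closed p] z(2) by blast
  then show False using z(1) assms(3) by blast
qed

end
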